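(* Let $H,K$ be finite dimensional complex Hilbert spaces, let $\mu$ be the unique unitarily invariant probability measure on the unit sphere $S(H\otimes H)$, and let $\phi:\mathcal B(K)\to\mathcal B(H)$ be a UCP map. For a unit vector $\xi\in H\otimes H$ let $\rho_\xi$ be the state of $\mathcal B(K\otimes H)$ determined by $\rho_\xi(a\otimes b)=\langle(\phi(a)\otimes b)\xi,\xi\rangle$, $a\in\mathcal B(K)$, $b\in\mathcal B(H)$. The following are equivalent: (i) for $\mu$-almost every $\xi\in S(H\otimes H)$, $\rho_\xi$ is entangled; (ii) there is a Borel subset of $S(H\otimes H)$ of positive $\mu$-measure such that $\rho_\xi$ is entangled for every $\xi$ in it; (iii) for every marginally cyclic unit vector $\xi\in H\otimes H$, $\rho_\xi$ is entangled, i.e. $\phi$ preserves entanglement; (iv) there exists a marginally cyclic unit vector $\xi\in H\otimes H$ such that $\rho_\xi$ is entangled.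
   Context: A state of $\mathcal B(K\otimes H)$ is separable if it is a convex combination of product states $a\otimes b\mapsto\sigma(a)\tau(b)$ with $\sigma,\tau$ states of $\mathcal B(K)$, $\mathcal B(H)$; otherwise it is entangled. A unit vector $\xi\in H\otimes H$ is marginally cyclic if $(\mathcal B(H)\otimes\mathbf 1)\xi=H\otimes H$, equivalently if $(\mathbf 1\otimes b)\xi=0$ implies $b=0$ for $b\in\mathcal B(H)$. A UCP map preserves entanglement if $\rho_\xi$ is entangled for every marginally cyclic unit vector $\xi$. *)

theory Defs
  imports "HOL-Probability.Probability"
begin

text \<open>Finite dimensional complex Hilbert spaces are modelled as complex^'n for a finite
index type 'n; operators in B(H) as matrices complex^'n^'n; H tensor K as complex^('n * 'm).\<close>

definition cinner :: "complex^('n::finite) \<Rightarrow> complex^'n \<Rightarrow> complex" where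
  "cinner x y = (\<Sum>i\<in>UNIV. x$i * cnj (y$i))"

definition adj :: "complex^('n::finite)^('m::finite) \<Rightarrow> complex^'m^'n" where
  "adj A = (\<chi> i j. cnj (A$j$i))"

definition nonneg :: "complex \<Rightarrow> bool" where
  "nonneg z \<longleftrightarrow> Im z = 0 \<and> Re z \<ge> 0"

definition tensor :: "complex^('a::finite)^'a \<Rightarrow> complex^('b::finite)^'b \<Rightarrow> complex^('a \<times> 'b)^('a \<times> 'b)" where
  "tensor a b = (\<chi> p q. a$(fst p)$(fst q) * b$(snd p)$(snd q))"

definition smat :: "complex \<Rightarrow> complex^('n::finite)^('m::finite) \<Rightarrow> complex^'n^'m" where
  "smat c X = (\<chi> i j. c * X$i$j)"

definition clinear_fun :: "(complex^('n::finite)^'n \<Rightarrow> complex) \<Rightarrow> bool" where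
  "clinear_fun w \<longleftrightarrow> (\<forall>X Y. w (X + Y) = w X + w Y) \<and> (\<forall>c X. w (smat c X) = c * w X)"

definition clinear_map :: "(complex^('k::finite)^'k \<Rightarrow> complex^('h::finite)^'h) \<Rightarrow> bool" where
  "clinear_map f \<longleftrightarrow> (\<forall>X Y. f (X + Y) = f X + f Y) \<and> (\<forall>c X. f (smat c X) = smat c (f X))"

definition is_state :: "(complex^('n::finite)^'n \<Rightarrow> complex) \<Rightarrow> bool" where
  "is_state w \<longleftrightarrow> clinear_fun w \<and> w (mat 1) = 1 \<and> (\<forall>X::complex^'n^'n. nonneg (w (adj X ** X)))"

definition block_pos :: "nat \<Rightarrow> (nat \<Rightarrow> nat \<Rightarrow> complex^('n::finite)^'n) \<Rightarrow> bool" where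
  "block_pos n a \<longleftrightarrow> (\<forall>v :: nat \<Rightarrow> complex^'n.
      nonneg (\<Sum>i<n. \<Sum>j<n. cinner (a i j *v v j) (v i)))"

definition completely_positive :: "(complex^('k::finite)^'k \<Rightarrow> complex^'h^'h) \<Rightarrow> bool" where
  "completely_positive f \<longleftrightarrow>
     (\<forall>n (a::nat \<Rightarrow> nat \<Rightarrow> complex^'k^'k). block_pos n a \<longrightarrow> block_pos n (\<lambda>i j. f (a i j)))"

definition ucp :: "(complex^('k::finite)^'k \<Rightarrow> complex^('h::finite)^'h) \<Rightarrow> bool" where
  "ucp f \<longleftrightarrow> clinear_map f \<and> f (mat 1) = mat 1 \<and> completely_positive f"

definition prod_state ::
  "(complex^('k::finite)^'k \<Rightarrow> complex) \<Rightarrow> (complex^('h::finite)^'h \<Rightarrow> complex)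
     \<Rightarrow> complex^('k \<times> 'h)^('k \<times> 'h) \<Rightarrow> complex" where
  "prod_state \<sigma> \<tau> = (THE w. clinear_fun w \<and> (\<forall>a b. w (tensor a b) = \<sigma> a * \<tau> b))"

definition separable :: "(complex^('k::finite \<times> 'h::finite)^('k \<times> 'h) \<Rightarrow> complex) \<Rightarrow> bool" where
  "separable w \<longleftrightarrow> (\<exists>(N::nat) (c::nat \<Rightarrow> real) s t.
       (\<forall>i<N. c i \<ge> 0 \<and> is_state (s i :: complex^'k^'k \<Rightarrow> complex)
                \<and> is_state (t i :: complex^'h^'h \<Rightarrow> complex)) \<and> (\<Sum>i<N. c i) = 1 \<and>
       w = (\<lambda>X. \<Sum>i<N. complex_of_real (c i) * prod_state (s i) (t i) X))"

definition entangled :: "(complex^(('k::finite) \<times> ('h::finite))^('k \<times> 'h) \<Rightarrow> complex) \<Rightarrow> bool" where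
  "entangled w \<longleftrightarrow> is_state w \<and> \<not> separable w"

definition rho :: "(complex^('k::finite)^'k \<Rightarrow> complex^('h::finite)^'h) \<Rightarrow> complex^('h \<times> 'h)
     \<Rightarrow> complex^('k \<times> 'h)^('k \<times> 'h) \<Rightarrow> complex" where
  "rho \<phi> \<xi> = (THE w. clinear_fun w \<and>
      (\<forall>a b. w (tensor a b) = cinner (tensor (\<phi> a) b *v \<xi>) \<xi>))"

definition marginally_cyclic :: "complex^(('h::finite) \<times> 'h) \<Rightarrow> bool" where
  "marginally_cyclic \<xi> \<longleftrightarrow> range (\<lambda>a::complex^'h^'h. tensor a (mat 1) *v \<xi>) = UNIV"

definition unitary :: "complex^('n::finite)^'n \<Rightarrow> bool" where
  "unitary U \<longleftrightarrow> adj U ** U = mat 1"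

definition preserves_entanglement :: "(complex^('k::finite)^'k \<Rightarrow> complex^('h::finite)^'h) \<Rightarrow> bool" where
  "preserves_entanglement \<phi> \<longleftrightarrow>
     (\<forall>\<xi>::complex^('h \<times> 'h). norm \<xi> = 1 \<and> marginally_cyclic \<xi> \<longrightarrow> entangled (rho \<phi> \<xi>))"

end

theory Submission
  imports Defs
begin

text \<open>If \<open>\<xi>\<close> is marginally cyclic, every \<open>\<eta>\<close> has the form \<open>(1 \<otimes> C)\<xi>\<close>, and then
  \<open>\<rho>\<^sub>\<eta>(a \<otimes> b) = \<rho>\<^sub>\<xi>(a \<otimes> C\<^sup>*bC)\<close>. Hence a separable decomposition of \<open>\<rho>\<^sub>\<xi>\<close> yields one of
  \<open>\<rho>\<^sub>\<eta>\<close>: a single entangled \<open>\<rho>\<^sub>\<eta>\<close> forces \<open>\<rho>\<^sub>\<xi>\<close> to be entangled for all marginally cyclic \<open>\<xi>\<close>.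
  Identifying \<open>\<xi>\<close> with a square matrix, marginal cyclicity is invertibility, so it remains to see
  that the zero set of the determinant is null. A Borel set is null for an invariant probability
  measure as soon as it has infinitely many unitary translates of bounded overlap, and both the
  hyperplanes \<open>\<xi>\<^sub>p = 0\<close> and the singular matrices with nonzero diagonal have such translates,
  the overlap being bounded by the degree of a nonzero polynomial.\<close>

section \<open>Entrywise calculus of matrices, adjoints and tensor products\<close>

lemma smat_nth [simp]: "smat c X $ i $ j = c * X $ i $ j"
  by (simp add: smat_def)

lemma adj_nth [simp]: "adj A $ i $ j = cnj (A $ j $ i)"
  by (simp add: adj_def)

lemma tensor_nth [simp]: "tensor a b $ p $ q = a $ fst p $ fst q * b $ snd p $ snd q"
  by (simp add: tensor_def)

lemma sum_UNIV_prod: "(\<Sum>p\<in>UNIV. f p) = (\<Sum>i\<in>UNIV. \<Sum>j\<in>UNIV. f (i, j))"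
  by (simp add: sum.cartesian_product)

lemma cinner_add_left: "cinner (x + y) z = cinner x z + cinner y z"
  by (simp add: cinner_def sum.distrib distrib_right)

lemma cinner_scale_left: "cinner (c *s x) z = c * cinner x z"
  by (simp add: cinner_def sum_distrib_left mult.assoc)

lemma cinner_self: "cinner x x = complex_of_real ((norm x)\<^sup>2)"
  by (simp add: cinner_def norm_vec_def L2_set_def sum_nonneg complex_norm_square del: of_real_power)

lemma cinner_adj: "cinner (A *v x) y = cinner x (adj A *v y)"
proof -
  have "cinner (A *v x) y = (\<Sum>i\<in>UNIV. \<Sum>j\<in>UNIV. A $ i $ j * x $ j * cnj (y $ i))"
    by (simp add: cinner_def matrix_vector_mult_def sum_distrib_right)
  also have "\<dots> = (\<Sum>j\<in>UNIV. \<Sum>i\<in>UNIV. A $ i $ j * x $ j * cnj (y $ i))"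
    by (rule sum.swap)
  also have "\<dots> = cinner x (adj A *v y)"
    by (simp add: cinner_def matrix_vector_mult_def sum_distrib_left mult_ac)
  finally show ?thesis .
qed

lemma smat_mult_vec: "smat c X *v x = c *s (X *v x)"
  by (simp add: vec_eq_iff matrix_vector_mult_def sum_distrib_left mult.assoc)

lemma adj_matrix_mult: "adj (A ** B) = adj B ** adj A"
  by (simp add: vec_eq_iff matrix_matrix_mult_def mult.commute)

lemma adj_adj [simp]: "adj (adj A) = A"
  by (simp add: vec_eq_iff)

lemma adj_mat_1 [simp]: "adj (mat 1) = mat 1"
  by (simp add: vec_eq_iff mat_def)

lemma tensor_matrix_mult: "tensor a b ** tensor c d = tensor (a ** c) (b ** d)"
  by (simp add: vec_eq_iff matrix_matrix_mult_def sum_UNIV_prod sum_product mult_ac)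

lemma adj_tensor: "adj (tensor a b) = tensor (adj a) (adj b)"
  by (simp add: vec_eq_iff)

lemma tensor_mat_1: "tensor (mat 1) (mat 1) = mat 1"
  by (auto simp: vec_eq_iff mat_def)

lemma tensor_add_left: "tensor (a + a') b = tensor a b + tensor a' b"
  and tensor_add_right: "tensor a (b + b') = tensor a b + tensor a b'"
  and tensor_smat_left: "tensor (smat c a) b = smat c (tensor a b)"
  and tensor_smat_right: "tensor a (smat c b) = smat c (tensor a b)"
  by (simp_all add: vec_eq_iff algebra_simps)

lemma matrix_add_mult: "(A + B) ** C = A ** C + B ** (C :: 'a::semiring_1^'n^'m)"
  by (simp add: vec_eq_iff matrix_matrix_mult_def distrib_right sum.distrib)

lemma matrix_mult_smat: "A ** smat c B = smat c (A ** B)"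
  and smat_matrix_mult: "smat c A ** B = smat c (A ** B)"
  by (simp_all add: vec_eq_iff matrix_matrix_mult_def sum_distrib_left mult_ac)

section \<open>Matrix units\<close>

definition matrix_unit :: "'n \<Rightarrow> 'n \<Rightarrow> complex^'n^'n" where
  "matrix_unit i j = (\<chi> r s. if r = i \<and> s = j then 1 else 0)"

lemma matrix_unit_nth: "matrix_unit i j $ r $ s = (if r = i \<and> s = j then 1 else 0)"
  by (simp add: matrix_unit_def)

lemma tensor_matrix_unit:
  "tensor (matrix_unit i k) (matrix_unit j l) = matrix_unit (i, j) (k, l)"
  by (auto simp: vec_eq_iff matrix_unit_nth)

lemma adj_matrix_unit: "adj (matrix_unit i j) = matrix_unit j i"
  by (auto simp: vec_eq_iff matrix_unit_nth)

lemma matrix_unit_mult: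
  "matrix_unit i j ** matrix_unit k l = (if j = k then matrix_unit i l else 0)"
  by (auto simp: vec_eq_iff matrix_matrix_mult_def matrix_unit_nth if_distrib[of "\<lambda>x. x * _"]
      sum.delta cong: if_cong)

lemma matrix_unit_expansion:
  "X = (\<Sum>i\<in>UNIV. \<Sum>j\<in>UNIV. smat (X $ i $ j) (matrix_unit i j))"
proof -
  have "(\<Sum>i\<in>UNIV. \<Sum>j\<in>UNIV. X $ i $ j * (if r = i \<and> s = j then 1 else 0)) = X $ r $ s" for r s
  proof -
    have "(\<Sum>j\<in>UNIV. X $ i $ j * (if r = i \<and> s = j then 1 else 0)) = (if r = i then X $ i $ s else 0)"
      for i
      by (cases "r = i") (simp_all add: if_distrib[of "\<lambda>x. _ * x"] sum.delta cong: if_cong)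
    then show ?thesis
      by (simp add: sum.delta)
  qed
  then show ?thesis
    by (simp add: vec_eq_iff matrix_unit_nth)
qed

section \<open>Linear functionals and their values on elementary tensors\<close>

lemma clinear_funD:
  assumes "clinear_fun w"
  shows "w (X + Y) = w X + w Y" "w (smat c X) = c * w X"
  using assms by (auto simp: clinear_fun_def)

lemma clinear_fun_0: "clinear_fun w \<Longrightarrow> w 0 = 0"
  using clinear_funD(1)[of w 0 0] by simp

lemma clinear_fun_sum:
  assumes "clinear_fun w"
  shows "w (\<Sum>i\<in>A. f i) = (\<Sum>i\<in>A. w (f i))"
  by (induction A rule: infinite_finite_induct)
     (simp_all add: clinear_fun_0[OF assms] clinear_funD[OF assms])

lemma clinear_fun_expansion:
  assumes "clinear_fun w"
  shows "w X = (\<Sum>i\<in>UNIV. \<Sum>j\<in>UNIV. X $ i $ j * w (matrix_unit i j))"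
  by (subst matrix_unit_expansion) (simp add: clinear_fun_sum[OF assms] clinear_funD[OF assms])

text \<open>Every matrix unit of the large algebra is a tensor of two matrix units, so elementary
  tensors span.\<close>

lemma tensor_functional_unique:
  assumes "clinear_fun w" "clinear_fun w'" "\<And>a b. w (tensor a b) = w' (tensor a b)"
  shows "w = w'"
proof
  have "w (matrix_unit p q) = w' (matrix_unit p q)" for p q
    using assms(3)[of "matrix_unit (fst p) (fst q)" "matrix_unit (snd p) (snd q)"]
    by (simp add: tensor_matrix_unit)
  then show "w X = w' X" for X
    by (subst clinear_fun_expansion[OF assms(1)], subst clinear_fun_expansion[OF assms(2)]) simp
qed

text \<open>Universal property of the tensor product: a bilinear \<open>f\<close> is prescribed on
  pairs of matrix units and extended linearly.\<close>

lemma tensor_functional_exists: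
  fixes f :: "complex^('a::finite)^'a \<Rightarrow> complex^('b::finite)^'b \<Rightarrow> complex"
  assumes l: "\<And>b. clinear_fun (\<lambda>a. f a b)" and r: "\<And>a. clinear_fun (f a)"
  shows "\<exists>w. clinear_fun w \<and> (\<forall>a b. w (tensor a b) = f a b)"
proof -
  define w where "w = (\<lambda>X. \<Sum>p\<in>UNIV. \<Sum>q\<in>UNIV. X $ p $ q *
     f (matrix_unit (fst p) (fst q)) (matrix_unit (snd p) (snd q)))"
  have "clinear_fun w"
    by (simp add: clinear_fun_def w_def sum.distrib algebra_simps sum_distrib_left)
  moreover have "w (tensor a b) = f a b" for a b
  proof -
    have "w (tensor a b) = (\<Sum>i\<in>UNIV. \<Sum>j\<in>UNIV. \<Sum>k\<in>UNIV. \<Sum>l\<in>UNIV.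
        a $ i $ k * (b $ j $ l * f (matrix_unit i k) (matrix_unit j l)))"
      by (simp add: w_def sum_UNIV_prod mult_ac)
    also have "\<dots> = (\<Sum>i\<in>UNIV. \<Sum>k\<in>UNIV. \<Sum>j\<in>UNIV. \<Sum>l\<in>UNIV.
        a $ i $ k * (b $ j $ l * f (matrix_unit i k) (matrix_unit j l)))"
      by (intro sum.cong refl sum.swap)
    also have "\<dots> = (\<Sum>i\<in>UNIV. \<Sum>k\<in>UNIV. a $ i $ k * f (matrix_unit i k) b)"
      by (subst (2) clinear_fun_expansion[OF r]) (simp add: sum_distrib_left)
    also have "\<dots> = f a b"
      by (rule clinear_fun_expansion[OF l, symmetric])
    finally show ?thesis .
  qed
  ultimately show ?thesis by blast
qed

text \<open>Existence and uniqueness make the \<open>THE\<close> in \<open>prod_state\<close> and in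
  \<open>rho\<close> meaningful.\<close>

lemma tensor_functional_the:
  assumes "\<And>b. clinear_fun (\<lambda>a. f a b)" "\<And>a. clinear_fun (f a)"
  defines "w \<equiv> THE w. clinear_fun w \<and> (\<forall>a b. w (tensor a b) = f a b)"
  shows "clinear_fun w" "w (tensor a b) = f a b"
proof -
  have "\<exists>!w. clinear_fun w \<and> (\<forall>a b. w (tensor a b) = f a b)"
    using tensor_functional_exists[of f, OF assms(1,2)]
    by (auto intro!: ex_ex1I tensor_functional_unique)
  from theI'[OF this] show "clinear_fun w" "w (tensor a b) = f a b"
    by (auto simp: w_def)
qed

lemma prod_state_spec:
  assumes "clinear_fun \<sigma>" "clinear_fun \<tau>"
  shows clinear_fun_prod_state: "clinear_fun (prod_state \<sigma> \<tau>)"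
    and prod_state_tensor: "prod_state \<sigma> \<tau> (tensor a b) = \<sigma> a * \<tau> b"
  unfolding prod_state_def
  by (rule tensor_functional_the(1)[of "\<lambda>a b. \<sigma> a * \<tau> b"]
      tensor_functional_the(2)[of "\<lambda>a b. \<sigma> a * \<tau> b"];
      use assms in \<open>simp add: clinear_fun_def algebra_simps\<close>)+

lemma rho_spec:
  fixes \<phi> :: "complex^('k::finite)^'k \<Rightarrow> complex^('h::finite)^'h"
  assumes "clinear_map \<phi>"
  shows clinear_fun_rho: "clinear_fun (rho \<phi> \<xi>)"
    and rho_tensor: "rho \<phi> \<xi> (tensor a b) = cinner (tensor (\<phi> a) b *v \<xi>) \<xi>"
  unfolding rho_def
  by (rule tensor_functional_the(1)[of "\<lambda>a b. cinner (tensor (\<phi> a) b *v \<xi>) \<xi>"]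
      tensor_functional_the(2)[of "\<lambda>a b. cinner (tensor (\<phi> a) b *v \<xi>) \<xi>"];
      use assms in \<open>simp add: clinear_fun_def clinear_map_def tensor_add_left tensor_add_right
        tensor_smat_left tensor_smat_right matrix_vector_mult_add_rdistrib cinner_add_left
        smat_mult_vec cinner_scale_left\<close>)+

subsection \<open>The functionals \<open>\<rho>\<^sub>\<xi>\<close>\<close>

text \<open>An operator on the tensor product is read as a matrix over the first algebra, indexed by
  the second factor; \<open>block_pos\<close> and \<open>completely_positive\<close> speak of
  operators in this shape.\<close>

definition block :: "complex^(('a::finite) \<times> ('b::finite))^('a \<times> 'b) \<Rightarrow> 'b \<Rightarrow> 'b \<Rightarrow> complex^'a^'a" where
  "block X j l = (\<chi> i k. X $ (i, j) $ (k, l))"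

definition slice :: "complex^(('a::finite) \<times> ('b::finite)) \<Rightarrow> 'b \<Rightarrow> complex^'a" where
  "slice x j = (\<chi> i. x $ (i, j))"

lemma cinner_blocks:
  "cinner (X *v x) y = (\<Sum>j\<in>UNIV. \<Sum>l\<in>UNIV. cinner (block X j l *v slice x l) (slice y j))"
proof -
  have "cinner (X *v x) y = (\<Sum>i\<in>UNIV. \<Sum>j\<in>UNIV. \<Sum>k\<in>UNIV. \<Sum>l\<in>UNIV.
      X $ (i, j) $ (k, l) * x $ (k, l) * cnj (y $ (i, j)))"
    by (simp add: cinner_def matrix_vector_mult_def sum_UNIV_prod sum_distrib_right)
  also have "\<dots> = (\<Sum>j\<in>UNIV. \<Sum>i\<in>UNIV. \<Sum>k\<in>UNIV. \<Sum>l\<in>UNIV.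
      X $ (i, j) $ (k, l) * x $ (k, l) * cnj (y $ (i, j)))"
    by (rule sum.swap)
  also have "\<dots> = (\<Sum>j\<in>UNIV. \<Sum>i\<in>UNIV. \<Sum>l\<in>UNIV. \<Sum>k\<in>UNIV.
      X $ (i, j) $ (k, l) * x $ (k, l) * cnj (y $ (i, j)))"
    by (intro sum.cong refl sum.swap)
  also have "\<dots> = (\<Sum>j\<in>UNIV. \<Sum>l\<in>UNIV. \<Sum>i\<in>UNIV. \<Sum>k\<in>UNIV.
      X $ (i, j) $ (k, l) * x $ (k, l) * cnj (y $ (i, j)))"
    by (intro sum.cong refl sum.swap)
  finally show ?thesis
    by (simp add: cinner_def matrix_vector_mult_def sum_distrib_right block_def slice_def)
qed

lemma block_add: "block (X + Y) j l = block X j l + block Y j l"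
  and block_smat: "block (smat c X) j l = smat c (block X j l)"
  and block_tensor: "block (tensor a b) j l = smat (b $ j $ l) a"
  by (simp_all add: vec_eq_iff block_def)

text \<open>The right side applies \<open>\<phi>\<close> blockwise and evaluates the resulting form
  at \<open>\<xi>\<close>. Both sides are linear and agree on elementary tensors; the right one is
  accessible to complete positivity.\<close>

lemma rho_blocks:
  fixes \<phi> :: "complex^('k::finite)^'k \<Rightarrow> complex^('h::finite)^'h"
  assumes "clinear_map \<phi>"
  shows "rho \<phi> \<xi> X = (\<Sum>j\<in>UNIV. \<Sum>l\<in>UNIV. cinner (\<phi> (block X j l) *v slice \<xi> l) (slice \<xi> j))"
proof -
  define w where
    "w = (\<lambda>X. \<Sum>j\<in>UNIV. \<Sum>l\<in>UNIV. cinner (\<phi> (block X j l) *v slice \<xi> l) (slice \<xi> j))"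
  have "clinear_fun w"
    using assms by (simp add: clinear_fun_def clinear_map_def w_def block_add block_smat sum.distrib cinner_add_left
        matrix_vector_mult_add_rdistrib smat_mult_vec cinner_scale_left sum_distrib_left)
  moreover have "w (tensor a b) = rho \<phi> \<xi> (tensor a b)" for a b
    using assms
    by (simp add: rho_tensor[OF assms] cinner_blocks block_tensor w_def clinear_map_def)
  ultimately have "w = rho \<phi> \<xi>"
    by (intro tensor_functional_unique clinear_fun_rho assms)
  then show ?thesis by (simp add: w_def fun_eq_iff)
qed

text \<open>The blocks of \<open>adj X ** X\<close> form a positive block matrix,
  \<open>\<phi>\<close> keeps it positive, and the slices of \<open>\<xi>\<close> are the test
  vectors.\<close>

lemma is_state_rho:
  fixes \<phi> :: "complex^('k::finite)^'k \<Rightarrow> complex^('h::finite)^'h"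
  assumes "ucp \<phi>" "norm \<xi> = 1"
  shows "is_state (rho \<phi> \<xi>)"
proof -
  have lin: "clinear_map \<phi>" and cp: "completely_positive \<phi>" and [simp]: "\<phi> (mat 1) = mat 1"
    using assms(1) by (auto simp: ucp_def)
  \<comment> \<open>\<open>block_pos\<close> indexes blocks by natural numbers, so the index type
    \<open>'h\<close> has to be enumerated.\<close>
  obtain e :: "nat \<Rightarrow> 'h" where e: "bij_betw e {..<CARD('h)} UNIV"
    using ex_bij_betw_nat_finite[of "UNIV :: 'h set"] by (auto simp: lessThan_atLeast0)
  have reindex: "(\<Sum>i<CARD('h). \<Sum>j<CARD('h). f (e i) (e j)) = (\<Sum>i\<in>UNIV. \<Sum>j\<in>UNIV. f i j)"
    for f :: "'h \<Rightarrow> 'h \<Rightarrow> complex"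
    using sum.reindex_bij_betw[OF e, of "\<lambda>i. \<Sum>j\<in>UNIV. f i j"]
      sum.reindex_bij_betw[OF e, of "f _"] by simp
  have "nonneg (rho \<phi> \<xi> (adj X ** X))" for X :: "complex^('k \<times> 'h)^('k \<times> 'h)"
  proof -
    define Y where "Y = adj X ** X"
    have "block_pos CARD('h) (\<lambda>i j. block Y (e i) (e j))"
      unfolding block_pos_def
    proof
      fix v :: "nat \<Rightarrow> complex^'k"
      \<comment> \<open>The test vectors \<open>v j\<close> are glued into one vector whose slices
        they are.\<close>
      define V :: "complex^('k \<times> 'h)" where
        "V = (\<chi> p. v (inv_into {..<CARD('h)} e (snd p)) $ fst p)"
      have "slice V (e j) = v j" if "j < CARD('h)" for j
        using that e by (simp add: slice_def V_def vec_eq_iff bij_betw_def)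
      then have "(\<Sum>i<CARD('h). \<Sum>j<CARD('h). cinner (block Y (e i) (e j) *v v j) (v i))
         = (\<Sum>i<CARD('h). \<Sum>j<CARD('h). cinner (block Y (e i) (e j) *v slice V (e j)) (slice V (e i)))"
        by simp
      also have "\<dots> = cinner (Y *v V) V"
        by (simp add: cinner_blocks
            reindex[of "\<lambda>i j. cinner (block Y i j *v slice V j) (slice V i)"])
      also have "\<dots> = cinner (X *v V) (X *v V)"
        by (simp add: Y_def cinner_adj adj_matrix_mult matrix_vector_mul_assoc)
      finally show "nonneg (\<Sum>i<CARD('h). \<Sum>j<CARD('h). cinner (block Y (e i) (e j) *v v j) (v i))"
        by (simp add: cinner_self nonneg_def)
    qed
    then have "block_pos CARD('h) (\<lambda>i j. \<phi> (block Y (e i) (e j)))"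
      using cp by (auto simp: completely_positive_def)
    then have "nonneg (\<Sum>i<CARD('h). \<Sum>j<CARD('h).
        cinner (\<phi> (block Y (e i) (e j)) *v slice \<xi> (e j)) (slice \<xi> (e i)))"
      unfolding block_pos_def by (rule allE[of _ "\<lambda>i. slice \<xi> (e i)"])
    then show ?thesis
      by (simp add: rho_blocks[OF lin] Y_def
          reindex[of "\<lambda>i j. cinner (\<phi> (block Y i j) *v slice \<xi> j) (slice \<xi> i)", unfolded Y_def])
  qed
  moreover have "rho \<phi> \<xi> (mat 1) = 1"
    using rho_tensor[OF lin, of \<xi> "mat 1" "mat 1"] assms(2)
    by (simp add: tensor_mat_1 cinner_self)
  ultimately show ?thesis
    using clinear_fun_rho[OF lin] by (simp add: is_state_def)
qed

text \<open>The diagonal matrix units have nonnegative values with sum 0. Off the diagonal,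
  positivity on a perturbed diagonal unit takes the place of the Cauchy-Schwarz inequality.\<close>

lemma positive_functional_eq_0:
  fixes f :: "complex^('n::finite)^'n \<Rightarrow> complex"
  assumes lin: "clinear_fun f" and pos: "\<And>X::complex^'n^'n. nonneg (f (adj X ** X))" and "f (mat 1) = 0"
  shows "f X = 0"
proof -
  have diag: "f (matrix_unit i i) = 0" for i
  proof -
    have nn: "nonneg (f (matrix_unit j j))" for j
      using pos[of "matrix_unit j j"] by (simp add: adj_matrix_unit matrix_unit_mult)
    have "(\<Sum>j\<in>UNIV. f (matrix_unit j j)) = f (mat 1)"
      by (subst (2) clinear_fun_expansion[OF lin])
         (simp add: mat_def if_distrib[of "\<lambda>x. x * _"] cong: if_cong)
    then have "(\<Sum>j\<in>UNIV. Re (f (matrix_unit j j))) = 0"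
      using assms(3) by (metis Re_sum zero_complex.simps(1))
    then have "Re (f (matrix_unit i i)) = 0"
      using nn by (subst (asm) sum_nonneg_eq_0_iff) (auto simp: nonneg_def)
    then show ?thesis
      using nn[of i] by (simp add: nonneg_def complex_eq_iff)
  qed
  have "f (matrix_unit i j) = 0" for i j
  proof (cases "i = j")
    case False
    \<comment> \<open>For \<open>Y = matrix_unit i i + smat c (matrix_unit i j)\<close> the value at
      \<open>adj Y ** Y\<close> has two diagonal terms, which vanish, and these two cross
      terms.\<close>
    have nn: "nonneg (c * f (matrix_unit i j) + cnj c * f (matrix_unit j i))" for c
    proof -
      have "adj (matrix_unit i i + smat c (matrix_unit i j)) = matrix_unit i i + smat (cnj c) (matrix_unit j i)"
        by (auto simp: vec_eq_iff matrix_unit_nth)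
      then show ?thesis
        using pos[of "matrix_unit i i + smat c (matrix_unit i j)"] False
        by (simp add: matrix_add_ldistrib matrix_add_mult matrix_mult_smat smat_matrix_mult
            matrix_unit_mult clinear_funD[OF lin] diag add.commute)
    qed
    \<comment> \<open>Opposite signs of \<open>c\<close> force each cross sum to be 0: real
      \<open>c\<close> annihilates the sum of the two values, imaginary \<open>c\<close> their
      difference.\<close>
    show ?thesis
      using nn[of 1] nn[of "-1"] nn[of \<i>] nn[of "-\<i>"]
      by (auto simp: nonneg_def complex_eq_iff)
  qed (simp add: diag)
  then show ?thesis
    by (subst clinear_fun_expansion[OF lin]) simp
qed


text \<open>\<open>C\<close> acts on the second factor and commutes with \<open>\<phi> a\<close> on
  the first, so only \<open>b\<close> is conjugated.\<close>

lemma rho_local_transform: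
  assumes "clinear_map \<phi>"
  shows "rho \<phi> (tensor (mat 1) C *v \<xi>) (tensor a b) = rho \<phi> \<xi> (tensor a (adj C ** b ** C))"
proof -
  have "rho \<phi> (tensor (mat 1) C *v \<xi>) (tensor a b)
      = cinner (tensor (mat 1) C *v \<xi>) (adj (tensor (\<phi> a) b) *v (tensor (mat 1) C *v \<xi>))"
    by (simp add: rho_tensor[OF assms] cinner_adj)
  also have "\<dots> = cinner \<xi> (adj (tensor (\<phi> a) (adj C ** b ** C)) *v \<xi>)"
    by (simp add: cinner_adj matrix_vector_mul_assoc adj_tensor tensor_matrix_mult
        adj_matrix_mult matrix_mul_assoc)
  also have "\<dots> = rho \<phi> \<xi> (tensor a (adj C ** b ** C))"
    by (simp add: rho_tensor[OF assms] cinner_adj)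
  finally show ?thesis .
qed

lemma is_state_conjugate:
  fixes \<tau> :: "complex^('n::finite)^'n \<Rightarrow> complex" and C :: "complex^'n^'n"
  assumes "is_state \<tau>" and p: "p = Re (\<tau> (adj C ** C))" "p \<noteq> 0"
  shows "is_state (\<lambda>b. \<tau> (adj C ** b ** C) / p)"
proof -
  have lin: "clinear_fun \<tau>" and pos: "nonneg (\<tau> (adj X ** X))" for X :: "complex^'n^'n"
    using assms(1) by (auto simp: is_state_def)
  have p': "p > 0" "\<tau> (adj C ** C) = p"
    using pos[of C] p by (auto simp: nonneg_def complex_eq_iff)
  have "nonneg (\<tau> (adj C ** (adj X ** X) ** C) / p)" for X :: "complex^'n^'n"
    using pos[of "X ** C"] p'(1) by (simp add: nonneg_def adj_matrix_mult matrix_mul_assoc)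
  moreover have "clinear_fun (\<lambda>b. \<tau> (adj C ** b ** C) / p)"
    by (simp add: clinear_fun_def matrix_add_ldistrib matrix_add_mult matrix_mult_smat
        smat_matrix_mult clinear_funD[OF lin] add_divide_distrib)
  ultimately show ?thesis
    using p' by (simp add: is_state_def)
qed

text \<open>Complements \<open>is_state_conjugate\<close> when normalisation is impossible: the
  compressed functional is positive and vanishes at the identity.\<close>

lemma state_conjugate_eq_0:
  fixes \<tau> :: "complex^('n::finite)^'n \<Rightarrow> complex" and C :: "complex^'n^'n"
  assumes "is_state \<tau>" "Re (\<tau> (adj C ** C)) = 0"
  shows "\<tau> (adj C ** b ** C) = 0"
proof -
  have lin: "clinear_fun \<tau>" and pos: "nonneg (\<tau> (adj X ** X))" for X :: "complex^'n^'n"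
    using assms(1) by (auto simp: is_state_def)
  show ?thesis
  proof (rule positive_functional_eq_0[where f = "\<lambda>b. \<tau> (adj C ** b ** C)"])
    show "clinear_fun (\<lambda>b. \<tau> (adj C ** b ** C))"
      by (simp add: clinear_fun_def matrix_add_ldistrib matrix_add_mult matrix_mult_smat
          smat_matrix_mult clinear_funD[OF lin])
    show "nonneg (\<tau> (adj C ** (adj X ** X) ** C))" for X :: "complex^'n^'n"
      using pos[of "X ** C"] by (simp add: adj_matrix_mult matrix_mul_assoc)
    show "\<tau> (adj C ** mat 1 ** C) = 0"
      using assms(2) pos[of C] by (simp add: nonneg_def complex_eq_iff)
  qed
qed

text \<open>Conjugation by \<open>C\<close> turns the second state of each product into a multiple
  \<open>p i\<close> of a state; this factor is absorbed into the weight.\<close>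

lemma separable_rho_local_transform:
  fixes \<phi> :: "complex^('k::finite)^'k \<Rightarrow> complex^('h::finite)^'h"
  assumes "clinear_map \<phi>" "\<phi> (mat 1) = mat 1"
    and "separable (rho \<phi> \<xi>)" and \<eta>: "\<eta> = tensor (mat 1) C *v \<xi>" "norm \<eta> = 1"
  shows "separable (rho \<phi> \<eta>)"
proof -
  obtain N :: nat and c s t where st: "\<And>i. i < N \<Longrightarrow> c i \<ge> 0" "\<And>i. i < N \<Longrightarrow> is_state (s i)"
      "\<And>i. i < N \<Longrightarrow> is_state (t i)"
    and rho: "rho \<phi> \<xi> = (\<lambda>X. \<Sum>i<N. complex_of_real (c i) * prod_state (s i) (t i) X)"
    using assms(3) unfolding separable_def by blast
  have lin: "clinear_fun (s i)" "clinear_fun (t i)" if "i < N" for i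
    using st that by (auto simp: is_state_def)
  define p where "p i = Re (t i (adj C ** C))" for i
  have p_nonneg: "p i \<ge> 0" if "i < N" for i
    using st(3)[OF that] by (auto simp: is_state_def nonneg_def p_def)
  \<comment> \<open>If \<open>p i = 0\<close> the new weight is 0 and any state may stand here;
    \<open>t i\<close> is at hand.\<close>
  define t' where "t' i = (if p i = 0 then t i else (\<lambda>b. t i (adj C ** b ** C) / p i))" for i
  have t': "is_state (t' i)" if "i < N" for i
    using is_state_conjugate[OF st(3)[OF that] refl] st(3)[OF that] by (simp add: t'_def p_def)
  have pt': "p i * t' i b = t i (adj C ** b ** C)" if "i < N" for i b
    using state_conjugate_eq_0[OF st(3)[OF that]] by (simp add: t'_def p_def)
  define w where "w X = (\<Sum>i<N. complex_of_real (c i * p i) * prod_state (s i) (t' i) X)" for X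
  have lin': "clinear_fun (t' i)" if "i < N" for i
    using t'[OF that] by (simp add: is_state_def)
  have "clinear_fun w"
    using clinear_fun_prod_state[OF lin(1) lin']
    by (simp add: clinear_fun_def w_def sum.distrib distrib_left sum_distrib_left mult_ac)
  moreover have w_tensor: "w (tensor a b) = rho \<phi> \<eta> (tensor a b)" for a b
  proof -
    have "w (tensor a b) = (\<Sum>i<N. c i * (s i a * (p i * t' i b)))"
      by (simp add: w_def prod_state_tensor lin lin' mult_ac)
    also have "\<dots> = (\<Sum>i<N. c i * (s i a * t i (adj C ** b ** C)))"
      by (simp add: pt')
    also have "\<dots> = rho \<phi> \<eta> (tensor a b)"
      by (simp add: \<eta>(1) rho_local_transform[OF assms(1)] rho prod_state_tensor lin)
    finally show ?thesis .
  qed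
  ultimately have w: "w = rho \<phi> \<eta>"
    by (intro tensor_functional_unique clinear_fun_rho assms(1))
  \<comment> \<open>The new weights are summed by evaluating at the identity, where every product
    state gives 1 and \<open>rho \<phi> \<eta>\<close> gives the squared norm of
    \<open>\<eta>\<close>.\<close>
  have "complex_of_real (\<Sum>i<N. c i * p i) = w (tensor (mat 1) (mat 1))"
  proof -
    have "prod_state (s i) (t' i) (tensor (mat 1) (mat 1)) = 1" if "i < N" for i
      using st(2)[OF that] t'[OF that] by (simp add: prod_state_tensor is_state_def)
    then show ?thesis by (simp add: w_def)
  qed
  also have "\<dots> = cinner (tensor (mat 1) (mat 1) *v \<eta>) \<eta>"
    by (simp add: w_tensor rho_tensor[OF assms(1)] assms(2))
  also have "\<dots> = 1"
    by (simp add: tensor_mat_1 cinner_self \<eta>(2))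
  finally have "(\<Sum>i<N. c i * p i) = 1"
    by (simp only: of_real_eq_1_iff)
  then show ?thesis
    unfolding separable_def w[symmetric]
    by (intro exI[of _ N] exI[of _ "\<lambda>i. c i * p i"] exI[of _ s] exI[of _ t'])
       (auto simp: st t' p_nonneg w_def fun_eq_iff)
qed

subsection \<open>Marginally cyclic vectors\<close>

text \<open>The coefficient matrix of a vector: operators on the first factor multiply it from the
  left, transposes of those on the second from the right.\<close>

definition vec_matrix :: "complex^(('h::finite) \<times> 'h) \<Rightarrow> complex^'h^'h" where
  "vec_matrix \<xi> = (\<chi> i j. \<xi> $ (i, j))"

lemma vec_matrix_inject: "vec_matrix \<xi> = vec_matrix \<eta> \<longleftrightarrow> \<xi> = \<eta>"
  by (simp add: vec_eq_iff vec_matrix_def)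

lemma vec_matrix_tensor_left: "vec_matrix (tensor a (mat 1) *v \<xi>) = a ** vec_matrix \<xi>"
  by (simp add: vec_eq_iff vec_matrix_def matrix_vector_mult_def matrix_matrix_mult_def sum_UNIV_prod
      mat_def if_distrib[of "\<lambda>x. _ * x"] if_distrib[of "\<lambda>x. x * _"] cong: if_cong)

lemma vec_matrix_tensor_right:
  "vec_matrix (tensor (mat 1) b *v \<xi>) = vec_matrix \<xi> ** transpose b"
proof -
  have "(\<Sum>k\<in>UNIV. \<Sum>l\<in>UNIV. (if i = k then 1 else 0) * b $ j $ l * \<xi> $ (k, l))
      = (\<Sum>l\<in>UNIV. \<xi> $ (i, l) * b $ j $ l)" for i j
    by (subst sum.swap)
       (simp add: if_distrib[of "\<lambda>x. x * _"] if_distrib[of "\<lambda>x. _ * x"] mult.commute cong: if_cong)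
  then show ?thesis
    by (simp add: vec_eq_iff vec_matrix_def matrix_vector_mult_def matrix_matrix_mult_def
        sum_UNIV_prod mat_def transpose_def)
qed

lemma marginally_cyclic_iff_det:
  fixes \<xi> :: "complex^(('a::finite) \<times> 'a)"
  shows "marginally_cyclic \<xi> \<longleftrightarrow> det (vec_matrix \<xi>) \<noteq> 0"
proof
  assume "marginally_cyclic \<xi>"
  \<comment> \<open>This vector has the identity as coefficient matrix, so an operator reaching it
    is a left inverse of \<open>vec_matrix \<xi>\<close>.\<close>
  then have "(\<chi> p. if fst p = snd p then 1 else 0) \<in> range (\<lambda>a::complex^'a^'a. tensor a (mat 1) *v \<xi>)"
    by (simp add: marginally_cyclic_def)
  then obtain a where "tensor a (mat 1) *v \<xi> = (\<chi> p. if fst p = snd p then 1 else 0)"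
    by (elim rangeE) simp
  moreover have "vec_matrix (\<chi> p. if fst p = snd p then 1 else 0) = mat 1"
    by (simp add: vec_eq_iff vec_matrix_def mat_def)
  ultimately have "a ** vec_matrix \<xi> = mat 1"
    by (metis vec_matrix_tensor_left)
  then show "det (vec_matrix \<xi>) \<noteq> 0"
    by (metis det_I det_mul mult_zero_right zero_neq_one)
next
  assume "det (vec_matrix \<xi>) \<noteq> 0"
  then obtain B where B: "B ** vec_matrix \<xi> = mat 1"
    by (meson invertible_det_nz invertible_left_inverse)
  have "\<eta> = tensor (vec_matrix \<eta> ** B) (mat 1) *v \<xi>" for \<eta>
    by (simp add: vec_matrix_inject[symmetric] vec_matrix_tensor_left B matrix_mul_assoc[symmetric])
  then show "marginally_cyclic \<xi>"
    unfolding marginally_cyclic_def by blast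
qed

text \<open>Left and right invertibility agree for square matrices, so cyclicity passes from the
  first tensor factor to the second.\<close>

lemma marginally_cyclic_right_surj:
  assumes "marginally_cyclic \<xi>"
  obtains C where "\<eta> = tensor (mat 1) C *v \<xi>"
proof -
  obtain B where B: "vec_matrix \<xi> ** B = mat 1"
    using assms by (meson marginally_cyclic_iff_det invertible_det_nz invertible_right_inverse)
  have "\<eta> = tensor (mat 1) (transpose (B ** vec_matrix \<eta>)) *v \<xi>"
    by (simp add: vec_matrix_inject[symmetric] vec_matrix_tensor_right B matrix_mul_assoc)
  then show thesis by (rule that)
qed

text \<open>Cyclicity is asked of \<open>\<xi>\<close> alone: it lets \<open>\<eta>\<close> be
  reached from \<open>\<xi>\<close>, and a separable decomposition at \<open>\<xi>\<close> would be
  transported to \<open>\<eta>\<close>.\<close>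

lemma entangled_rho_marginally_cyclic:
  fixes \<phi> :: "complex^('k::finite)^'k \<Rightarrow> complex^('h::finite)^'h"
  assumes "ucp \<phi>" "norm \<eta> = 1" "entangled (rho \<phi> \<eta>)" "norm \<xi> = 1" "marginally_cyclic \<xi>"
  shows "entangled (rho \<phi> \<xi>)"
proof -
  obtain C where "\<eta> = tensor (mat 1) C *v \<xi>"
    by (rule marginally_cyclic_right_surj[OF assms(5)])
  with assms show ?thesis
    using separable_rho_local_transform[of \<phi> \<xi> \<eta> C] is_state_rho[of \<phi> \<xi>]
    by (auto simp: entangled_def ucp_def)
qed

text \<open>The maximally entangled vector, whose coefficient matrix is a nonzero multiple of the
  identity.\<close>

lemma marginally_cyclic_unit_vector:
  "\<exists>\<xi>::complex^(('h::finite) \<times> 'h). norm \<xi> = 1 \<and> marginally_cyclic \<xi>"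
proof -
  define \<omega> :: "complex^('h \<times> 'h)" where "\<omega> = (\<chi> p. if fst p = snd p then 1 else 0)"
  have "\<omega> \<noteq> 0"
    by (auto simp: \<omega>_def vec_eq_iff)
  define c where "c = inverse (norm \<omega>)"
  have c: "norm (c *\<^sub>R \<omega>) = 1" "c \<noteq> 0"
    using \<open>\<omega> \<noteq> 0\<close> by (simp_all add: c_def)
  have "vec_matrix (c *\<^sub>R \<omega>) = (\<chi> i j. if i = j then complex_of_real c else 0)"
    by (simp add: vec_eq_iff vec_matrix_def \<omega>_def of_real_def)
  then have "marginally_cyclic (c *\<^sub>R \<omega>)"
    using c(2) by (simp add: marginally_cyclic_iff_det det_diagonal)
  then show ?thesis
    using c(1) by blast
qed

subsection \<open>Null sets of unitarily invariant measures\<close>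

locale unitarily_invariant = prob_space \<mu> for \<mu> :: "(complex^('n::finite)) measure" +
  assumes sets_sphere: "sets \<mu> = sets (restrict_space borel (sphere 0 1))"
    and measure_unitary_image:
      "unitary U \<Longrightarrow> A \<in> sets \<mu> \<Longrightarrow> measure \<mu> ((\<lambda>x. U *v x) ` A) = measure \<mu> A"
begin

lemma space_sphere: "space \<mu> = sphere 0 1"
  using sets_eq_imp_space_eq[OF sets_sphere] by (simp add: space_restrict_space)

lemma sets_Int_sphere: "B \<in> sets borel \<Longrightarrow> sphere 0 1 \<inter> B \<in> sets \<mu>"
  by (auto simp: sets_sphere sets_restrict_space)

text \<open>Images under a unitary become preimages under its adjoint, which gives their
  measurability and a usable membership test.\<close>

lemma unitary_image_eq:
  assumes "unitary U" "A \<subseteq> sphere 0 1"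
  shows "(\<lambda>x. U *v x) ` A = {x \<in> sphere 0 1. adj U *v x \<in> A}"
proof -
  have U: "adj U ** U = mat 1" "U ** adj U = mat 1"
    using assms(1) by (simp_all add: unitary_def matrix_left_right_inverse)
  have isometry: "norm (U *v x) = norm x" for x
  proof -
    have "cinner (U *v x) (U *v x) = cinner x x"
      by (simp add: cinner_adj matrix_vector_mul_assoc U)
    then show ?thesis
      by (simp add: cinner_self flip: of_real_power)
  qed
  show ?thesis
  proof (intro equalityI subsetI)
    fix y assume "y \<in> (\<lambda>x. U *v x) ` A"
    then show "y \<in> {x \<in> sphere 0 1. adj U *v x \<in> A}"
      using assms(2) by (auto simp: isometry matrix_vector_mul_assoc U)
  next
    fix y assume "y \<in> {x \<in> sphere 0 1. adj U *v x \<in> A}"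
    then have "adj U *v y \<in> A" by simp
    moreover have "y = U *v (adj U *v y)"
      by (simp add: matrix_vector_mul_assoc U)
    ultimately show "y \<in> (\<lambda>x. U *v x) ` A" by blast
  qed
qed

lemma sets_unitary_image:
  assumes "unitary U" "A \<in> sets \<mu>"
  shows "(\<lambda>x. U *v x) ` A \<in> sets \<mu>"
proof -
  obtain B where B: "B \<in> sets borel" "A = sphere 0 1 \<inter> B"
    using assms(2) by (auto simp: sets_sphere sets_restrict_space)
  have "(\<lambda>x. adj U *v x) \<in> borel_measurable borel"
    by (intro borel_measurable_continuous_onI linear_continuous_on matrix_vector_mul_bounded_linear)
  then have "sphere 0 1 \<inter> (\<lambda>x. adj U *v x) -` (sphere 0 1 \<inter> B) \<in> sets \<mu>"
    using measurable_sets_borel[of "\<lambda>x. adj U *v x" borel "sphere 0 1 \<inter> B"] B(1)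
    by (intro sets_Int_sphere) auto
  also have "sphere 0 1 \<inter> (\<lambda>x. adj U *v x) -` (sphere 0 1 \<inter> B) = (\<lambda>x. U *v x) ` A"
    using unitary_image_eq[OF assms(1), of A] B by auto
  finally show ?thesis .
qed

text \<open>Integrating the sum of the first \<open>N\<close> indicators of the translates gives
  \<open>N * prob A \<le> D\<close> for every \<open>N\<close>.\<close>

lemma AE_notin_if_bounded_overlap:
  assumes A: "A \<in> sets \<mu>" and U: "\<And>k::nat. unitary (U k)"
    and overlap: "\<And>x. norm x = 1 \<Longrightarrow>
      finite {k. x \<in> (\<lambda>y. U k *v y) ` A} \<and> card {k. x \<in> (\<lambda>y. U k *v y) ` A} \<le> D"
  shows "AE x in \<mu>. x \<notin> A"
proof -
  define B where "B k = (\<lambda>y. U k *v y) ` A" for k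
  have B: "B k \<in> sets \<mu>" "prob (B k) = prob A" for k
    by (simp_all add: B_def sets_unitary_image measure_unitary_image A U)
  have "real N * prob A \<le> D" for N
  proof -
    have "real N * prob A = (\<Sum>k<N. \<integral>x. indicator (B k) x \<partial>\<mu>)"
      using B by simp
    also have "\<dots> = (\<integral>x. (\<Sum>k<N. indicator (B k) x) \<partial>\<mu>)"
      using B by (intro Bochner_Integration.integral_sum[symmetric]) (simp add: emeasure_eq_measure)
    also have "\<dots> \<le> (\<integral>x. real D \<partial>\<mu>)"
    proof (rule integral_mono)
      fix x assume "x \<in> space \<mu>"
      then have "finite {k. x \<in> B k}" "card {k. x \<in> B k} \<le> D"
        using overlap[of x] by (simp_all add: B_def space_sphere)
      moreover have "(\<Sum>k<N. indicator (B k) x :: real) = card {k\<in>{..<N}. x \<in> B k}"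
        by (simp add: indicator_def sum.If_cases Int_def)
      moreover have "card {k\<in>{..<N}. x \<in> B k} \<le> card {k. x \<in> B k}"
        using \<open>finite {k. x \<in> B k}\<close> by (intro card_mono) auto
      ultimately show "(\<Sum>k<N. indicator (B k) x) \<le> real D" by simp
    qed (use B in \<open>auto simp: emeasure_eq_measure\<close>)
    also have "\<dots> = D" by (simp add: prob_space)
    finally show ?thesis .
  qed
  then have "prob A = 0"
    by (metis reals_Archimedean3 linorder_not_less measure_nonneg order_le_less)
  then show ?thesis
    using A by (simp add: prob_eq_0)
qed

end

text \<open>The indices inject into the roots of \<open>p\<close>. Finiteness is stated separately
  because \<open>card\<close> of an infinite set is 0.\<close>

lemma poly_root_indices_bound:
  fixes p :: "'a::idom poly"
  assumes "inj t" "p \<noteq> 0" "\<And>k. P k \<Longrightarrow> poly p (t k) = 0" "degree p \<le> D"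
  shows "finite {k. P k} \<and> card {k. P k} \<le> D"
proof -
  have sub: "t ` {k. P k} \<subseteq> {z. poly p z = 0}" and inj: "inj_on t {k. P k}"
    using assms by (auto intro: inj_on_subset)
  have fin: "finite {z. poly p z = 0}"
    using assms(2) by (rule poly_roots_finite)
  have "card {k. P k} \<le> card {z. poly p z = 0}"
    using card_mono[OF fin sub] by (simp add: card_image inj)
  moreover have "finite {k. P k}"
    using finite_subset[OF sub fin] inj by (rule finite_imageD)
  ultimately show ?thesis
    using card_poly_roots_bound[OF assms(2)] assms(4) by linarith
qed

text \<open>Lets real rotations with a prescribed column serve as unitaries.\<close>

lemma orthogonal_unitary:
  assumes "orthogonal_matrix Q"
  shows "unitary (\<chi> i j. complex_of_real (Q $ i $ j))"
proof -
  have "(\<Sum>k\<in>UNIV. Q $ k $ i * Q $ k $ j) = (if i = j then 1 else 0)" for i j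
    using assms by (simp add: orthogonal_matrix_def vec_eq_iff matrix_matrix_mult_def transpose_def mat_def)
  from arg_cong[OF this, of complex_of_real] show ?thesis
    by (simp add: unitary_def vec_eq_iff matrix_matrix_mult_def mat_def)
qed

context unitarily_invariant
begin

text \<open>The rotated hyperplanes have normal vectors on the moment curve, so a nonzero vector lies in
  a number of them bounded by the dimension.\<close>

lemma AE_component_nonzero: "AE x in \<mu>. x $ p \<noteq> 0"
proof -
  define A :: "(complex^'n) set" where "A = sphere 0 1 \<inter> {x. x $ p = 0}"
  \<comment> \<open>Distinct exponents for the coordinates, so that a vector can be read as the
    coefficients of a polynomial.\<close>
  obtain e :: "'n \<Rightarrow> nat" and n where e: "inj e" "range e = {i. i < n}"
    using finite_imp_inj_to_nat_seg[of "UNIV :: 'n set"] by auto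
  then have e_less: "e i < n" for i
    by blast
  define r :: "nat \<Rightarrow> real^'n" where "r k = (\<chi> i. real (Suc k) ^ e i)" for k
  have r: "r k \<noteq> 0" for k
    by (auto simp: r_def vec_eq_iff)
  \<comment> \<open>With the normalised \<open>r k\<close> as its column \<open>p\<close>,
    \<open>Q\<close> carries the coordinate hyperplane to the one orthogonal to
    \<open>r k\<close>.\<close>
  have "\<forall>k. \<exists>Q. orthogonal_matrix Q \<and> Q *v axis p 1 = inverse (norm (r k)) *\<^sub>R r k"
  proof
    fix k
    have "norm (inverse (norm (r k)) *\<^sub>R r k) = 1"
      using r by simp
    then show "\<exists>Q. orthogonal_matrix Q \<and> Q *v axis p 1 = inverse (norm (r k)) *\<^sub>R r k"
      by (rule orthogonal_matrix_exists_basis[where k = p]) blast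
  qed
  from choice[OF this] obtain Q where Q: "\<And>k. orthogonal_matrix (Q k)"
      "\<And>k. Q k *v axis p 1 = inverse (norm (r k)) *\<^sub>R r k"
    by blast
  define U where "U k = (\<chi> i j. complex_of_real (Q k $ i $ j))" for k
  have Qp: "Q k $ i $ p = inverse (norm (r k)) * real (Suc k) ^ e i" for k i
    using arg_cong[OF Q(2)[of k], of "\<lambda>x. x $ i"]
    by (simp add: r_def matrix_vector_mult_basis column_def)
  have U: "unitary (U k)" for k
    unfolding U_def by (rule orthogonal_unitary[OF Q(1)])
  have "AE x in \<mu>. x \<notin> A"
  proof (rule AE_notin_if_bounded_overlap[OF _ U])
    show "A \<in> sets \<mu>"
      unfolding A_def by (intro sets_Int_sphere borel_closed closed_Collect_eq continuous_intros)
    fix x :: "complex^'n" assume x: "norm x = 1"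
    \<comment> \<open>Pairing \<open>x\<close> with \<open>r k\<close> evaluates \<open>q\<close> at
      \<open>Suc k\<close>.\<close>
    define q where "q = (\<Sum>i\<in>UNIV. monom (x $ i) (e i))"
    have "coeff q (e i) = x $ i" for i
      using e(1) by (simp add: q_def coeff_sum inj_eq)
    moreover have "x \<noteq> 0"
      using x by auto
    ultimately have "q \<noteq> 0"
      by (metis coeff_0 vec_eq_iff zero_index)
    moreover have "degree q \<le> n"
      unfolding q_def using e_less
      by (intro degree_sum_le) (simp_all add: order_trans[OF degree_monom_le less_imp_le])
    moreover have "poly q (of_nat (Suc k)) = 0" if "x \<in> (\<lambda>y. U k *v y) ` A" for k
    proof -
      have "(adj (U k) *v x) $ p = 0"
        using that by (subst (asm) unitary_image_eq[OF U]) (auto simp: A_def)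
      also have "(adj (U k) *v x) $ p = of_real (inverse (norm (r k))) * poly q (of_nat (Suc k))"
        by (simp add: matrix_vector_mult_def U_def Qp q_def poly_sum poly_monom sum_distrib_left mult_ac
            del: of_nat_Suc)
      finally show ?thesis
        using r[of k] by simp
    qed
    moreover have "inj (\<lambda>k. of_nat (Suc k) :: complex)"
      by (auto simp: inj_def)
    ultimately show "finite {k. x \<in> (\<lambda>y. U k *v y) ` A} \<and> card {k. x \<in> (\<lambda>y. U k *v y) ` A} \<le> n"
      by (intro poly_root_indices_bound[where p = q])
  qed
  then show ?thesis
    using AE_space by eventually_elim (auto simp: A_def space_sphere)
qed

end

section \<open>Determinants of polynomial matrices and the null set of singular matrices\<close>

lemma poly_det: "poly (det A) z = det (\<chi> i j. poly (A $ i $ j) z)"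
  by (simp add: det_def poly_sum poly_prod)

lemma degree_det_le:
  fixes A :: "complex poly^'n^'n"
  assumes "\<And>i j. degree (A $ i $ j) \<le> 1"
  shows "degree (det A) \<le> CARD('n)"
  unfolding det_def
proof (rule degree_sum_le)
  fix p :: "'n \<Rightarrow> 'n"
  have "degree (\<Prod>i\<in>UNIV. A $ i $ p i) \<le> (\<Sum>i\<in>UNIV. degree (A $ i $ p i))"
    using degree_prod_sum_le[of UNIV "\<lambda>i. A $ i $ p i"] by (simp add: o_def)
  also have "\<dots> \<le> (\<Sum>i\<in>(UNIV::'n set). 1)"
    using assms by (intro sum_mono)
  finally show "degree (of_int (sign p) * (\<Prod>i\<in>UNIV. A $ i $ p i)) \<le> CARD('n)"
    using degree_mult_le[of "of_int (sign p)" "\<Prod>i\<in>UNIV. A $ i $ p i"] by simp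
qed (simp add: finite_permutations)

text \<open>Multiplying the off-diagonal entries of \<open>M\<close> by a phase \<open>z\<close> is a unitary operation on the
  vector of entries, and the determinant becomes a polynomial in \<open>z\<close> whose constant coefficient is
  the product of the diagonal entries, almost surely nonzero.\<close>

lemma AE_marginally_cyclic:
  fixes \<mu> :: "(complex^(('h::finite) \<times> 'h)) measure"
  assumes "unitarily_invariant \<mu>"
  shows "AE \<xi> in \<mu>. marginally_cyclic \<xi>"
proof -
  interpret unitarily_invariant \<mu> by fact
  define A :: "(complex^('h \<times> 'h)) set" where
    "A = sphere 0 1 \<inter> ({x. det (vec_matrix x) = 0} \<inter> (\<Inter>i. {x. x $ (i, i) \<noteq> 0}))"
  \<comment> \<open>The angles lie in the interval from 0 to \<open>pi\<close>, where the cosine is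
    injective; hence the phases are distinct.\<close>
  define w where "w k = cis (1 / Suc k)" for k
  define U :: "nat \<Rightarrow> complex^('h \<times> 'h)^('h \<times> 'h)" where
    "U k = (\<chi> p q. if p = q then if fst p = snd p then 1 else w k else 0)" for k
  have U: "unitary (U k)" for k
    by (auto simp: unitary_def vec_eq_iff matrix_matrix_mult_def mat_def U_def w_def cis_cnj cis_mult
        if_distrib[of "\<lambda>x. x * _"] if_distrib[of "\<lambda>x. _ * x"] if_distrib[of cnj] cong: if_cong)
  have adj_U: "(adj (U k) *v x) $ p = (if fst p = snd p then x $ p else cnj (w k) * x $ p)" for k x p
    by (auto simp: matrix_vector_mult_def U_def if_distrib[of "\<lambda>x. x * _"] if_distrib[of cnj] cong: if_cong)
  have "AE x in \<mu>. x \<notin> A"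
  proof (rule AE_notin_if_bounded_overlap[OF _ U])
    have "{x :: complex^('h \<times> 'h). det (vec_matrix x) = 0} \<in> sets borel"
      unfolding det_def vec_matrix_def
      by (intro borel_closed closed_Collect_eq continuous_intros)
    moreover have "open (\<Inter>i. {x :: complex^('h \<times> 'h). x $ (i, i) \<noteq> 0})"
      by (intro open_INT ballI open_Collect_neq continuous_intros) simp
    ultimately show "A \<in> sets \<mu>"
      unfolding A_def by (intro sets_Int_sphere sets.Int) auto
    fix x :: "complex^('h \<times> 'h)" assume x: "norm x = 1"
    \<comment> \<open>Evaluated at \<open>cnj (w k)\<close>, \<open>M\<close> is the coefficient
      matrix of \<open>adj (U k) *v x\<close>; at 0 only the diagonal survives.\<close>
    define M where "M = (\<chi> i j. if i = j then [:x $ (i, j):] else [:0, x $ (i, j):])"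
    have poly_M: "poly (det M) z = det (\<chi> i j. if i = j then x $ (i, j) else z * x $ (i, j))" for z
      by (simp add: poly_det M_def if_distrib[of "\<lambda>p. poly p z"] cong: if_cong)
    show "finite {k. x \<in> (\<lambda>y. U k *v y) ` A} \<and> card {k. x \<in> (\<lambda>y. U k *v y) ` A} \<le> CARD('h)"
    proof (cases "\<forall>i. x $ (i, i) \<noteq> 0")
      case True
      have "poly (det M) 0 = (\<Prod>i\<in>UNIV. x $ (i, i))"
        by (simp add: poly_M det_diagonal)
      then have "det M \<noteq> 0"
        using True by auto
      moreover have "degree (det M) \<le> CARD('h)"
        by (rule degree_det_le) (simp add: M_def)
      moreover have "poly (det M) (cnj (w k)) = 0" if "x \<in> (\<lambda>y. U k *v y) ` A" for k
      proof -
        have "adj (U k) *v x \<in> A"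
          using that by (subst (asm) unitary_image_eq[OF U]) (auto simp: A_def)
        then have "det (vec_matrix (adj (U k) *v x)) = 0"
          by (simp add: A_def)
        then show ?thesis
          by (simp add: poly_M vec_matrix_def adj_U)
      qed
      moreover have "inj (\<lambda>k. cnj (w k))"
      proof (rule injI)
        fix k l assume "cnj (w k) = cnj (w l)"
        then have cos_eq: "cos (1 / Suc k) = cos (1 / Suc l)"
          by (simp add: w_def complex_eq_iff)
        have le_pi: "1 / real (Suc m) \<le> pi" for m
        proof -
          have "1 / real (Suc m) \<le> 1" by simp
          then show ?thesis using pi_ge_two by linarith
        qed
        have "1 / real (Suc k) = 1 / real (Suc l)"
          by (rule cos_inj_pi[OF _ le_pi _ le_pi cos_eq]) simp_all
        then show "k = l" by simp
      qed
      ultimately show ?thesis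
        by (intro poly_root_indices_bound[where p = "det M"])
    next
      \<comment> \<open>The unitaries fix the diagonal coordinates, so a vector with a zero there
        lies in no translate of \<open>A\<close>.\<close>
      case False
      then obtain i where i: "x $ (i, i) = 0" by blast
      have "x \<notin> (\<lambda>y. U k *v y) ` A" for k
      proof
        assume "x \<in> (\<lambda>y. U k *v y) ` A"
        then have "adj (U k) *v x \<in> A"
          by (subst (asm) unitary_image_eq[OF U]) (auto simp: A_def)
        then show False
          using i by (auto simp: A_def adj_U)
      qed
      then show ?thesis by simp
    qed
  qed
  \<comment> \<open>The singular matrices outside \<open>A\<close> lie in finitely many coordinate
    hyperplanes, each of them null.\<close>
  moreover have "AE x in \<mu>. \<forall>i\<in>UNIV. x $ (i, i) \<noteq> 0"
    by (rule AE_finite_allI) (simp_all add: AE_component_nonzero)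
  ultimately show ?thesis
    using AE_space
    by eventually_elim (auto simp: A_def space_sphere marginally_cyclic_iff_det)
qed

section \<open>Equivalence of generic, positive-measure, universal and existential
  entanglement\<close>

theorem theorem3p1:
  fixes \<phi> :: "complex^'k^'k \<Rightarrow> complex^'h^'h"
    and \<mu> :: "(complex^('h \<times> 'h)) measure"
  assumes "ucp \<phi>"
    and "prob_space \<mu>"
    and "sets \<mu> = sets (restrict_space borel (sphere 0 1))"
    and "\<And>U A. unitary U \<Longrightarrow> A \<in> sets \<mu> \<Longrightarrow> measure \<mu> ((\<lambda>x. U *v x) ` A) = measure \<mu> A"
  shows "((AE \<xi> in \<mu>. entangled (rho \<phi> \<xi>))
           \<longleftrightarrow> (\<exists>A \<in> sets \<mu>. measure \<mu> A > 0 \<and> (\<forall>\<xi>\<in>A. entangled (rho \<phi> \<xi>))))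
       \<and> ((\<exists>A \<in> sets \<mu>. measure \<mu> A > 0 \<and> (\<forall>\<xi>\<in>A. entangled (rho \<phi> \<xi>)))
           \<longleftrightarrow> preserves_entanglement \<phi>)
       \<and> (preserves_entanglement \<phi>
           \<longleftrightarrow> (\<exists>\<xi>::complex^('h \<times> 'h). norm \<xi> = 1 \<and> marginally_cyclic \<xi> \<and> entangled (rho \<phi> \<xi>)))"
    (is "(?i \<longleftrightarrow> ?ii) \<and> (?ii \<longleftrightarrow> ?iii) \<and> (?iii \<longleftrightarrow> ?iv)")
proof -
  interpret prob_space \<mu> by fact
  have inv: "unitarily_invariant \<mu>"
    using assms by (intro unitarily_invariant.intro unitarily_invariant_axioms.intro) auto
  have space: "space \<mu> = sphere 0 1"
    by (rule unitarily_invariant.space_sphere[OF inv])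
  have "?ii" if "?i"
  proof -
    \<comment> \<open>The exceptional set is not known to be Borel; a measurable null set covering
      it is removed instead.\<close>
    from that obtain N where N: "N \<in> null_sets \<mu>" "{\<xi> \<in> space \<mu>. \<not> entangled (rho \<phi> \<xi>)} \<subseteq> N"
      by (auto elim: AE_E3 AE_E simp: eventually_ae_filter)
    have "measure \<mu> (space \<mu> - N) = 1"
      using N(1) prob_compl[of N] by (auto simp: null_sets_def measure_def)
    then show ?ii
      using N by (intro bexI[of _ "space \<mu> - N"]) auto
  qed
  moreover have "?iii" if "?ii"
  proof -
    from that obtain A where A: "A \<in> sets \<mu>" "measure \<mu> A > 0" "\<forall>\<xi>\<in>A. entangled (rho \<phi> \<xi>)"
      by blast
    \<comment> \<open>A single entangled point of \<open>A\<close> settles all marginally cyclic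
      vectors.\<close>
    then have "A \<noteq> {}" by auto
    then obtain \<eta> where "\<eta> \<in> A" by blast
    moreover have "norm \<eta> = 1"
      using \<open>\<eta> \<in> A\<close> sets.sets_into_space[OF A(1)] by (auto simp: space)
    ultimately show ?iii
      using A(3) entangled_rho_marginally_cyclic[OF assms(1), of \<eta>]
      by (auto simp: preserves_entanglement_def)
  qed
  \<comment> \<open>Unitary invariance enters here: almost every unit vector is marginally
    cyclic.\<close>
  moreover have "?i" if "?iii"
    using AE_marginally_cyclic[OF inv] AE_space
    by eventually_elim (use that in \<open>auto simp: preserves_entanglement_def space\<close>)
  moreover have "?iii" if "?iv"
    using that entangled_rho_marginally_cyclic[OF assms(1)]
    by (auto simp: preserves_entanglement_def)
  moreover have "?iv" if "?iii"
    using that marginally_cyclic_unit_vector by (auto simp: preserves_entanglement_def)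
  ultimately show ?thesis by blast
qed

end
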